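(* Let $\mathbb{F}$ be a field, $n\in\mathbb{N}$, and let $A\in\mathbb{F}^{n\times n}$ be a matrix with elementary divisors $f_1,\dots,f_k\in\mathbb{F}[X]$. Then there exists a basis $B$ of $V=\mathbb{F}^n$ (identified with the matrix in $\mathrm{GL}(n,\mathbb{F})$ whose rows are the basis vectors) such that $$A^{B^{-1}} = BAB^{-1}=\bigoplus_{i=1}^{k} J(f_i),$$ where $J(f_i)$ is the generalised Jordan block of $f_i$.
   Context: Vectors in $V=\mathbb{F}^n$ are row vectors and matrices act on them from the right. For $C\in\mathrm{GL}(n,\mathbb{F})$, $A^{C}:=C^{-1}AC$. The direct sum $\bigoplus$ of matrices is the block-diagonal matrix. A subspace $W\le V$ is $A$-invariant if $WA\subseteq W$; in that case $A|_W$ denotes the restriction of (the linear map) $A$ to $W$. An $A$-invariant subspace $W$ is $A$-cyclic if there is $w\in W$ with $W=\langle w\rangle_A:=\{wp(A)\mid p\in\mathbb{F}[X]\}$. A matrix or restriction is primary if its minimal polynomial is a power of an irreducible polynomial. Elementary divisors: $V$ can be written as a direct sum $V=\bigoplus_i W_i$ of non-zero $A$-invariant subspaces such that each $W_i$ is $A$-cyclic and each $A|_{W_i}$ is primary; the minimal polynomials of the restrictions $A|_{W_i}$ (listed with repetition; they are independent, up to order, of the chosen decomposition) are called the elementary divisors of $A$. Each elementary divisor is thus of the form $p^m$ with $p$ monic irreducible and $m\ge 1$. Companion matrix: for monic $p=X^d+c_{d-1}X^{d-1}+\dots+c_0$, $M_p\in\mathbb{F}^{d\times d}$ has entries $1$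 at positions $(j,j+1)$ for $1\le j\le d-1$, last row $(-c_0,-c_1,\dots,-c_{d-1})$, and all other entries $0$. Generalised Jordan block: for $p$ monic irreducible of degree $d$ and $m\ge 1$, $J(p^m)\in\mathbb{F}^{md\times md}$ is the block matrix with $m\times m$ blocks of size $d\times d$, having $M_p$ in every diagonal block, $N_d$ in every block immediately above the diagonal (block positions $(i,i+1)$), and zero blocks elsewhere. Here $N_d\in\mathbb{F}^{d\times d}$ has entry $1$ at position $(d,1)$ and $0$ elsewhere. *)

theory Defs
  imports "Jordan_Normal_Form.VS_Connect" "Jordan_Normal_Form.Gauss_Jordan_Elimination"
    "HOL-Computational_Algebra.Polynomial_Factorial"
begin

definition GL :: "nat \<Rightarrow> 'a::field mat set" where
  "GL n = Units (ring_mat TYPE('a) n ())"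

definition mat_inv :: "'a::field mat \<Rightarrow> 'a mat" where
  "mat_inv C = m_inv (ring_mat TYPE('a) (dim_row C) ()) C"

definition mat_conj :: "'a::field mat \<Rightarrow> 'a mat \<Rightarrow> 'a mat" where
  "mat_conj A C = mat_inv C * A * C"

text \<open>Matrices act on row vectors from the right; \<open>vec\<close> itself does not distinguish
  rows from columns, so the row vector \<open>w A\<close> has entries \<open>w \<bullet> col A j\<close>.\<close>

definition row_act :: "'a::semiring_0 vec \<Rightarrow> 'a mat \<Rightarrow> 'a vec" (infixl "\<odot>\<^sub>r" 70) where
  "w \<odot>\<^sub>r A = vec (dim_col A) (\<lambda>j. w \<bullet> col A j)"

definition poly_mat :: "'a::field poly \<Rightarrow> 'a mat \<Rightarrow> 'a mat" where
  "poly_mat p A =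
     finsum (ring_mat TYPE('a) (dim_row A) ()) (\<lambda>k. coeff p k \<cdot>\<^sub>m (A ^\<^sub>m k)) {..degree p}"

abbreviation is_subspace :: "nat \<Rightarrow> 'a::field vec set \<Rightarrow> bool" where
  "is_subspace n W \<equiv> VectorSpace.subspace class_ring W (module_vec TYPE('a) n)"

abbreviation is_basis :: "nat \<Rightarrow> 'a::field vec set \<Rightarrow> bool" where
  "is_basis n S \<equiv> VectorSpace.vectorspace.basis class_ring (module_vec TYPE('a) n) S"

definition invariant_subspace :: "nat \<Rightarrow> 'a::field mat \<Rightarrow> 'a vec set \<Rightarrow> bool" where
  "invariant_subspace n A W \<longleftrightarrow> is_subspace n W \<and> (\<forall>w\<in>W. w \<odot>\<^sub>r A \<in> W)"

definition cyclic_span :: "'a::field mat \<Rightarrow> 'a vec \<Rightarrow> 'a vec set" where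
  "cyclic_span A w = {w \<odot>\<^sub>r poly_mat p A | p. True}"

definition cyclic_subspace :: "'a::field mat \<Rightarrow> 'a vec set \<Rightarrow> bool" where
  "cyclic_subspace A W \<longleftrightarrow> (\<exists>w\<in>W. W = cyclic_span A w)"

text \<open>For an \<open>A\<close>-invariant \<open>W\<close>, the restriction satisfies \<open>p(A|\<^sub>W) = 0\<close> iff \<open>w p(A) = 0\<close>
  for all \<open>w \<in> W\<close>.\<close>

definition annihilates_on :: "nat \<Rightarrow> 'a::field mat \<Rightarrow> 'a vec set \<Rightarrow> 'a poly \<Rightarrow> bool" where
  "annihilates_on n A W p \<longleftrightarrow> (\<forall>w\<in>W. w \<odot>\<^sub>r poly_mat p A = 0\<^sub>v n)"

definition is_min_poly_on :: "nat \<Rightarrow> 'a::field mat \<Rightarrow> 'a vec set \<Rightarrow> 'a poly \<Rightarrow> bool" where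
  "is_min_poly_on n A W f \<longleftrightarrow> lead_coeff f = 1 \<and> annihilates_on n A W f \<and>
     (\<forall>q. q \<noteq> 0 \<and> annihilates_on n A W q \<longrightarrow> degree f \<le> degree q)"

definition primary_on :: "nat \<Rightarrow> 'a::field mat \<Rightarrow> 'a vec set \<Rightarrow> bool" where
  "primary_on n A W \<longleftrightarrow> (\<exists>p m. irreducible p \<and> is_min_poly_on n A W (p ^ m))"

definition is_direct_sum :: "nat \<Rightarrow> 'a::field vec set list \<Rightarrow> bool" where
  "is_direct_sum n Ws \<longleftrightarrow>
     (\<forall>v\<in>carrier_vec n. \<exists>!ws. list_all2 (\<in>) ws Ws \<and>
        v = finsum_vec TYPE('a) n ((!) ws) {..<length Ws})"

text \<open>The elementary divisors are only determined up to order, hence a relation: \<open>fs\<close> is a list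
  of the elementary divisors of \<open>A\<close>, with repetition, in some order.\<close>

definition elementary_divisors :: "nat \<Rightarrow> 'a::field mat \<Rightarrow> 'a poly list \<Rightarrow> bool" where
  "elementary_divisors n A fs \<longleftrightarrow>
     (\<exists>Ws. is_direct_sum n Ws \<and>
        (\<forall>W\<in>set Ws. invariant_subspace n A W \<and> W \<noteq> {0\<^sub>v n} \<and>
           cyclic_subspace A W \<and> primary_on n A W) \<and>
        list_all2 (is_min_poly_on n A) Ws fs)"

text \<open>All matrix positions below are counted from 0.\<close>

definition companion_mat :: "'a::field poly \<Rightarrow> 'a mat" where
  "companion_mat p = (let d = degree p in
     mat d d (\<lambda>(i, j). if i = d - 1 then - coeff p j else if j = i + 1 then 1 else 0))"

definition corner_mat :: "nat \<Rightarrow> 'a::field mat" where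
  "corner_mat d = mat d d (\<lambda>(i, j). if i = d - 1 \<and> j = 0 then 1 else 0)"

definition jordan_block_of :: "'a::field poly \<Rightarrow> nat \<Rightarrow> 'a mat" where
  "jordan_block_of p m = (let d = degree p in
     mat (m * d) (m * d) (\<lambda>(i, j).
       if j div d = i div d then companion_mat p $$ (i mod d, j mod d)
       else if j div d = i div d + 1 then corner_mat d $$ (i mod d, j mod d)
       else 0))"

definition gen_jordan_block :: "'a::field poly \<Rightarrow> 'a mat" where
  "gen_jordan_block f = (THE J. \<exists>p m. lead_coeff p = 1 \<and> irreducible p \<and> 1 \<le> m \<and> f = p ^ m \<and>
     J = jordan_block_of p m)"

lemma monic_irreducible_power_unique:
  fixes p q :: "'a::field poly"
  assumes "lead_coeff p = 1" "irreducible p" "1 \<le> m"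
    and "lead_coeff q = 1" "irreducible q" "1 \<le> k"
    and eq: "p ^ m = q ^ k"
  shows "p = q \<and> m = k"
proof -
  have pr: "prime_elem p"
    using assms(2) by (rule field_poly_irreducible_imp_prime)
  have "p dvd q ^ k"
    using assms(3) eq by (metis dvd_power le_zero_eq less_le_trans less_one not_less)
  then have pq: "p dvd q"
    using pr prime_elem_dvd_power by blast
  then obtain r where r: "q = p * r" by (elim dvdE)
  have "is_unit r"
    using irreducibleD[OF assms(5) r] pr prime_elem_not_unit by blast
  then obtain c where c: "r = [:c:]" by (metis is_unit_poly_iff)
  have "c = 1"
    using assms(1,4) r c lead_coeff_mult[of p r] by simp
  then have "p = q" using r c by (simp add: one_pCons[symmetric])
  moreover have "degree p > 0"
    using assms(2) by (metis bot_nat_0.not_eq_extremum irreducible_def is_unit_iff_degree)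
  moreover have "m * degree p = k * degree q"
    using eq degree_power_eq[of p m] degree_power_eq[of q k] assms(2,5)
    by (metis irreducible_def)
  ultimately show ?thesis by simp
qed

lemma gen_jordan_block_power:
  assumes "lead_coeff p = 1" "irreducible p" "1 \<le> m"
  shows "gen_jordan_block (p ^ m) = jordan_block_of p m"
  unfolding gen_jordan_block_def
  using assms monic_irreducible_power_unique by (intro the_equality) blast+

end

theory Submission
  imports Defs
begin

text \<open>
  The idea is to regard \<open>V\<close> as a module over the polynomial ring, with \<open>X\<close> acting as \<open>A\<close>.
  Elementary divisors come with a decomposition of \<open>V\<close> into cyclic submodules, each of the
  form \<open>W = \<langle>w\<rangle>\<close> with minimal polynomial \<open>f = p\<^sup>m\<close> and therefore isomorphic to \<open>F[X]/(p\<^sup>m)\<close>.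
  In this quotient, any choice of one polynomial for each degree below \<open>degree f\<close> gives a
  basis (\<open>cyclic_row_basis\<close>).

  The choice that yields the generalised Jordan block is the family of all \<open>p\<^sup>a X\<^sup>t\<close> with
  \<open>a < m\<close> and \<open>t < d\<close>, where \<open>d\<close> is the degree of \<open>p\<close>. Multiplication by \<open>X\<close> sends
  \<open>p\<^sup>a X\<^sup>t\<close> to \<open>p\<^sup>a X\<^bsup>t + 1\<^esup>\<close> as long as \<open>t + 1 < d\<close>, which gives the ones in the companion
  matrices. For \<open>t = d - 1\<close> it gives
  \<open>p\<^sup>a X\<^sup>d = p\<^bsup>a + 1\<^esup> - (\<Sum>t<d. c\<^sub>t p\<^sup>a X\<^sup>t)\<close>, where \<open>c\<^sub>t\<close> are the coefficients of \<open>p\<close>. The sum is the last row of the companion matrix, and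
  \<open>p\<^bsup>a + 1\<^esup>\<close>, the first member of the next group, is the one in the corner of the block above
  the diagonal. For \<open>a = m - 1\<close> that member is \<open>p\<^sup>m\<close>, which is zero in the quotient
  (\<open>X_mult_jordan_poly_block\<close>, \<open>graded_rows_jordan_block\<close>).

  It remains to put the summands together. If the rows of \<open>B\<close> are a basis of a summand, the
  computation says \<open>B A = J B\<close>. Stacking these matrices gives a matrix whose rows are a basis
  of \<open>V\<close>, because the sum is direct (\<open>direct_sum_row_basis\<close>), and for which the same equation
  holds with the block-diagonal matrix of all \<open>J\<close> (\<open>stack_rows_intertwines\<close>). The stacked
  matrix is invertible (\<open>row_basis_carrier_vec_inverse\<close>), and multiplying by its inverse
  finishes the proof.
\<close>

section \<open>Matrices and polynomials acting on row vectors\<close>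

lemma row_act_transpose:
  fixes A :: "'a::field mat"
  assumes "A \<in> carrier_mat k m" "w \<in> carrier_vec k"
  shows "w \<odot>\<^sub>r A = A\<^sup>T *\<^sub>v w"
  using assms by (auto simp: row_act_def intro!: eq_vecI comm_scalar_prod[of _ k])

lemma row_act_carrier:
  "A \<in> carrier_mat k m \<Longrightarrow> w \<odot>\<^sub>r A \<in> carrier_vec m"
  by (simp add: row_act_def)

lemma row_act_index:
  assumes "A \<in> carrier_mat k m" "w \<in> carrier_vec k" "j < m"
  shows "(w \<odot>\<^sub>r A) $ j = (\<Sum>i<k. w $ i * A $$ (i, j))"
  using assms by (simp add: row_act_def scalar_prod_def atLeast0LessThan)

lemma row_act_add:
  fixes A :: "'a::field mat"
  assumes "A \<in> carrier_mat k m" "v \<in> carrier_vec k" "w \<in> carrier_vec k"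
  shows "(v + w) \<odot>\<^sub>r A = v \<odot>\<^sub>r A + w \<odot>\<^sub>r A"
  using assms by (simp add: row_act_transpose[of A k m] mult_add_distrib_mat_vec[of _ m k])

lemma row_act_smult:
  fixes A :: "'a::field mat"
  assumes "A \<in> carrier_mat k m" "v \<in> carrier_vec k"
  shows "(c \<cdot>\<^sub>v v) \<odot>\<^sub>r A = c \<cdot>\<^sub>v (v \<odot>\<^sub>r A)"
  using assms by (simp add: row_act_transpose[of A k m] mult_mat_vec[of _ m k])

lemma row_act_mult:
  fixes A :: "'a::field mat"
  assumes "A \<in> carrier_mat k l" "B \<in> carrier_mat l m" "v \<in> carrier_vec k"
  shows "v \<odot>\<^sub>r (A * B) = (v \<odot>\<^sub>r A) \<odot>\<^sub>r B"
proof -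
  have "v \<odot>\<^sub>r (A * B) = (B\<^sup>T * A\<^sup>T) *\<^sub>v v"
    using assms by (simp add: row_act_transpose[of "A * B" k m] transpose_mult[of A k l B m])
  also have "\<dots> = B\<^sup>T *\<^sub>v (A\<^sup>T *\<^sub>v v)"
    using assms by (simp add: assoc_mult_mat_vec[of _ m l _ k])
  finally show ?thesis
    using assms by (simp add: row_act_transpose[of B l m] row_act_transpose[of A k l])
qed

lemma row_act_zero_vec [simp]:
  fixes A :: "'a::field mat"
  assumes "A \<in> carrier_mat k m"
  shows "0\<^sub>v k \<odot>\<^sub>r A = 0\<^sub>v m"
  using assms by (intro eq_vecI) (auto simp: row_act_index[of A k m] row_act_def)

lemma row_mult_row_act:
  fixes A :: "'a::field mat"
  assumes "B \<in> carrier_mat k l" "A \<in> carrier_mat l m" "i < k"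
  shows "row (B * A) i = row B i \<odot>\<^sub>r A"
  using assms by (intro eq_vecI) (auto simp: row_act_def)

lemma unit_vec_row_act:
  fixes B :: "'a::field mat"
  assumes "B \<in> carrier_mat k m" "i < k"
  shows "unit_vec k i \<odot>\<^sub>r B = row B i"
  using assms by (intro eq_vecI) (auto simp: row_act_def)

text \<open>The degree bound \<open>N\<close> is arbitrary so that several polynomials can be compared with one
  common range of summation.\<close>

lemma
  fixes A :: "'a::field mat"
  assumes A: "A \<in> carrier_mat n n"
  shows poly_mat_carrier: "poly_mat p A \<in> carrier_mat n n"
    and poly_mat_index: "\<And>i j N. i < n \<Longrightarrow> j < n \<Longrightarrow> degree p \<le> N \<Longrightarrow>
      poly_mat p A $$ (i, j) = (\<Sum>k\<le>N. coeff p k * (A ^\<^sub>m k) $$ (i, j))"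
proof -
  interpret R: ring "ring_mat TYPE('a) n ()" by (rule ring_mat)
  have fin: "finsum (ring_mat TYPE('a) n ()) (\<lambda>k. coeff p k \<cdot>\<^sub>m (A ^\<^sub>m k)) {..M} \<in> carrier_mat n n \<and>
    (\<forall>i<n. \<forall>j<n. finsum (ring_mat TYPE('a) n ()) (\<lambda>k. coeff p k \<cdot>\<^sub>m (A ^\<^sub>m k)) {..M} $$ (i, j)
      = (\<Sum>k\<le>M. coeff p k * (A ^\<^sub>m k) $$ (i, j)))" for M
  proof (induction M)
    case 0
    then show ?case using A by (simp add: ring_mat_simps)
  next
    case (Suc M)
    have "(\<lambda>k. coeff p k \<cdot>\<^sub>m (A ^\<^sub>m k)) \<in> {..Suc M} \<rightarrow> carrier_mat n n" using A by auto
    moreover have "dim_row (finsum (ring_mat TYPE('a) n ()) (\<lambda>k. coeff p k \<cdot>\<^sub>m (A ^\<^sub>m k)) {..M}) = n"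
      "dim_col (finsum (ring_mat TYPE('a) n ()) (\<lambda>k. coeff p k \<cdot>\<^sub>m (A ^\<^sub>m k)) {..M}) = n"
      using Suc by auto
    ultimately show ?case using A Suc by (simp add: ring_mat_simps add.commute)
  qed
  show "poly_mat p A \<in> carrier_mat n n"
    using A fin by (simp add: poly_mat_def)
  fix i j N assume ij: "i < n" "j < n" "degree p \<le> N"
  have "(\<Sum>k\<le>degree p. coeff p k * (A ^\<^sub>m k) $$ (i, j)) = (\<Sum>k\<le>N. coeff p k * (A ^\<^sub>m k) $$ (i, j))"
    using ij by (intro sum.mono_neutral_left) (auto simp: coeff_eq_0)
  then show "poly_mat p A $$ (i, j) = (\<Sum>k\<le>N. coeff p k * (A ^\<^sub>m k) $$ (i, j))"
    using A fin ij by (simp add: poly_mat_def)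
qed

lemma poly_act_carrier [simp]:
  fixes A :: "'a::field mat"
  assumes "A \<in> carrier_mat n n"
  shows "w \<odot>\<^sub>r poly_mat p A \<in> carrier_vec n"
  by (rule row_act_carrier[OF poly_mat_carrier[OF assms]])

lemma poly_act_add:
  fixes A :: "'a::field mat"
  assumes A: "A \<in> carrier_mat n n" and w: "w \<in> carrier_vec n"
  shows "w \<odot>\<^sub>r poly_mat (p + q) A = w \<odot>\<^sub>r poly_mat p A + w \<odot>\<^sub>r poly_mat q A"
proof -
  let ?N = "max (degree p) (degree q)"
  note c = poly_mat_carrier[OF A]
  have "poly_mat (p + q) A $$ (i, j) = poly_mat p A $$ (i, j) + poly_mat q A $$ (i, j)"
    if "i < n" "j < n" for i j
    using that poly_mat_index[OF A that, of _ ?N]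
    by (simp add: degree_add_le sum.distrib ring_distribs)
  then show ?thesis
    using w by (intro eq_vecI)
      (auto simp: row_act_index[OF c w] sum.distrib ring_distribs carrier_vecD[OF poly_act_carrier[OF A]])
qed

lemma poly_act_smult:
  fixes A :: "'a::field mat"
  assumes A: "A \<in> carrier_mat n n" and w: "w \<in> carrier_vec n"
  shows "w \<odot>\<^sub>r poly_mat (Polynomial.smult a p) A = a \<cdot>\<^sub>v (w \<odot>\<^sub>r poly_mat p A)"
proof -
  note c = poly_mat_carrier[OF A]
  have "poly_mat (Polynomial.smult a p) A $$ (i, j) = a * poly_mat p A $$ (i, j)"
    if "i < n" "j < n" for i j
    using that poly_mat_index[OF A that, of _ "degree p"]
    by (simp add: sum_distrib_left ac_simps)
  then show ?thesis
    using w by (intro eq_vecI)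
      (auto simp: row_act_index[OF c w] sum_distrib_left ac_simps carrier_vecD[OF poly_act_carrier[OF A]])
qed

lemma poly_mat_0:
  fixes A :: "'a::field mat"
  assumes A: "A \<in> carrier_mat n n"
  shows "poly_mat 0 A = 0\<^sub>m n n"
  using A poly_mat_carrier[OF A, of 0] poly_mat_index[OF A, of _ _ 0 0]
  by (intro eq_matI) auto

lemma poly_mat_1:
  fixes A :: "'a::field mat"
  assumes A: "A \<in> carrier_mat n n"
  shows "poly_mat 1 A = 1\<^sub>m n"
  using A poly_mat_carrier[OF A, of 1] poly_mat_index[OF A, of _ _ 1 0]
  by (intro eq_matI) auto

lemma poly_mat_mult_X:
  fixes A :: "'a::field mat"
  assumes A: "A \<in> carrier_mat n n"
  shows "poly_mat (pCons 0 p) A = poly_mat p A * A"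
proof (intro eq_matI)
  note c = poly_mat_carrier[OF A] and ix = poly_mat_index[OF A]
  fix i j assume "i < dim_row (poly_mat p A * A)" "j < dim_col (poly_mat p A * A)"
  then have ij: "i < n" "j < n" using A c[of p] by auto
  have "poly_mat (pCons 0 p) A $$ (i, j) =
      (\<Sum>k\<le>Suc (degree p). coeff (pCons 0 p) k * (A ^\<^sub>m k) $$ (i, j))"
    by (rule ix[OF ij]) (simp add: degree_pCons_le)
  also have "\<dots> = (\<Sum>k\<le>degree p. coeff p k * (A ^\<^sub>m k * A) $$ (i, j))"
    by (subst sum.atMost_Suc_shift) simp
  also have "\<dots> = (\<Sum>k\<le>degree p. \<Sum>l<n. coeff p k * (A ^\<^sub>m k) $$ (i, l) * A $$ (l, j))"
    using A ij by (simp add: scalar_prod_def sum_distrib_left ac_simps atLeast0LessThan)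
  also have "\<dots> = (\<Sum>l<n. (\<Sum>k\<le>degree p. coeff p k * (A ^\<^sub>m k) $$ (i, l)) * A $$ (l, j))"
    by (subst sum.swap) (simp add: sum_distrib_right)
  also have "\<dots> = (poly_mat p A * A) $$ (i, j)"
    using A c[of p] ij by (simp add: scalar_prod_def ix[OF _ _ order_refl] atLeast0LessThan)
  finally show "poly_mat (pCons 0 p) A $$ (i, j) = (poly_mat p A * A) $$ (i, j)" .
qed (use A poly_mat_carrier[OF A, of p] poly_mat_carrier[OF A, of "pCons 0 p"] in auto)

lemma poly_act_mult_X:
  fixes A :: "'a::field mat"
  assumes A: "A \<in> carrier_mat n n" and w: "w \<in> carrier_vec n"
  shows "w \<odot>\<^sub>r poly_mat (pCons 0 p) A = (w \<odot>\<^sub>r poly_mat p A) \<odot>\<^sub>r A"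
  using assms poly_mat_carrier[OF A] by (simp add: poly_mat_mult_X row_act_mult[of _ n n _ n])

lemma poly_act_0:
  fixes A :: "'a::field mat"
  assumes A: "A \<in> carrier_mat n n" and w: "w \<in> carrier_vec n"
  shows "w \<odot>\<^sub>r poly_mat 0 A = 0\<^sub>v n"
  using w by (intro eq_vecI) (auto simp: poly_mat_0[OF A] row_act_index[of _ n n] row_act_def)

lemma poly_act_1:
  fixes A :: "'a::field mat"
  assumes A: "A \<in> carrier_mat n n" and w: "w \<in> carrier_vec n"
  shows "w \<odot>\<^sub>r poly_mat 1 A = w"
  using w by (simp add: poly_mat_1[OF A] row_act_transpose[of _ n n])

text \<open>Together with additivity this makes the row space a module over the polynomial ring, with
  \<open>X\<close> acting as \<open>A\<close>. From here on, all computation with rows of the form \<open>w q(A)\<close> is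
  done with the polynomials \<open>q\<close> alone.\<close>

lemma poly_act_mult:
  fixes A :: "'a::field mat"
  assumes A: "A \<in> carrier_mat n n" and w: "w \<in> carrier_vec n"
  shows "w \<odot>\<^sub>r poly_mat (p * q) A = (w \<odot>\<^sub>r poly_mat p A) \<odot>\<^sub>r poly_mat q A"
proof (induction q)
  case 0
  show ?case using assms by (simp add: poly_act_0[OF A] poly_act_carrier[OF A])
next
  case (pCons a q)
  let ?v = "w \<odot>\<^sub>r poly_mat p A"
  have v: "?v \<in> carrier_vec n" by (rule poly_act_carrier[OF A])
  have "pCons a q = Polynomial.smult a 1 + pCons 0 q" by (simp add: one_pCons)
  then have "?v \<odot>\<^sub>r poly_mat (pCons a q) A = a \<cdot>\<^sub>v ?v + (?v \<odot>\<^sub>r poly_mat q A) \<odot>\<^sub>r A"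
    using A v by (simp only: poly_act_add poly_act_smult poly_act_1 poly_act_mult_X)
  then show ?case
    using assms by (simp add: poly_act_add poly_act_smult poly_act_mult_X pCons.IH)
qed

lemma poly_act_sum_index:
  fixes A :: "'a::field mat" and N :: nat
  assumes A: "A \<in> carrier_mat n n" and w: "w \<in> carrier_vec n" and j: "j < n"
  shows "(w \<odot>\<^sub>r poly_mat (\<Sum>k<N. Polynomial.smult (c k) (g k)) A) $ j =
    (\<Sum>k<N. c k * (w \<odot>\<^sub>r poly_mat (g k) A) $ j)"
proof (induction N)
  case 0
  show ?case using assms by (simp add: poly_act_0)
next
  case (Suc N)
  show ?case using Suc assms
    by (simp add: poly_act_add poly_act_smult carrier_vecD[OF poly_act_carrier[OF A]])
qed

section \<open>Polynomials of distinct degrees\<close>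

text \<open>Division by leading terms: subtracting the right multiple of \<open>g N\<close> removes the
  coefficient of degree \<open>N\<close>. Division with remainder by powers of \<open>p\<close> followed by
  expansion of the digits is the instance that gives generalised Jordan blocks.\<close>

lemma graded_polys_span:
  fixes g :: "nat \<Rightarrow> 'a::field poly"
  assumes "\<And>k. k < N \<Longrightarrow> g k \<noteq> 0 \<and> degree (g k) = k" and "\<And>k. N \<le> k \<Longrightarrow> coeff r k = 0"
  shows "\<exists>c. r = (\<Sum>k<N. Polynomial.smult (c k) (g k))"
  using assms
proof (induction N arbitrary: r)
  case 0
  then show ?case by (simp add: poly_eq_iff)
next
  case (Suc N)
  define a where "a = coeff r N / lead_coeff (g N)"
  have "coeff (r - Polynomial.smult a (g N)) k = 0" if "N \<le> k" for k
  proof (cases "k = N")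
    case True
    moreover have "coeff (g N) N \<noteq> 0"
      using Suc.prems(1)[of N] leading_coeff_0_iff[of "g N"] by simp
    ultimately show ?thesis using Suc.prems(1)[of N] by (simp add: a_def)
  next
    case False
    then show ?thesis using that Suc.prems(1)[of N] Suc.prems(2)[of k] by (simp add: coeff_eq_0)
  qed
  then obtain c where c: "r - Polynomial.smult a (g N) = (\<Sum>k<N. Polynomial.smult (c k) (g k))"
    using Suc.IH[of "r - Polynomial.smult a (g N)"] Suc.prems(1) by auto
  have "r = (\<Sum>k<Suc N. Polynomial.smult ((c(N := a)) k) (g k))"
    using c by (simp add: algebra_simps)
  then show ?case by blast
qed

lemma graded_polys_coeff:
  fixes g :: "nat \<Rightarrow> 'a::field poly"
  assumes "\<And>k. k < N \<Longrightarrow> degree (g k) = k" and "N \<le> j"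
  shows "coeff (\<Sum>k<N. Polynomial.smult (c k) (g k)) j = 0"
  using assms by (simp add: coeff_sum coeff_eq_0)

lemma graded_polys_independent:
  fixes g :: "nat \<Rightarrow> 'a::field poly"
  assumes "\<And>k. k < N \<Longrightarrow> g k \<noteq> 0 \<and> degree (g k) = k" and "(\<Sum>k<N. Polynomial.smult (c k) (g k)) = 0"
    and "k < N"
  shows "c k = 0"
  using assms
proof (induction N)
  case (Suc N)
  have "coeff (\<Sum>k<Suc N. Polynomial.smult (c k) (g k)) N = c N * lead_coeff (g N)"
    using graded_polys_coeff[of N g N c] Suc.prems(1) by simp
  then have "c N = 0" using Suc.prems(1)[of N] Suc.prems(2) leading_coeff_0_iff[of "g N"]
    by (simp only: coeff_0 mult_eq_0_iff) simp
  then show ?case using Suc by (cases "k = N") auto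
qed simp

section \<open>Bases of subspaces as rows of a matrix\<close>

text \<open>The rows of \<open>B\<close> form an ordered basis of \<open>W\<close>, expressed as unique coordinates rather than
  as span and independence of a set: the order of the rows matters for the matrix of \<open>A\<close>,
  and a set of rows would not notice repetitions.\<close>

definition row_basis :: "nat \<Rightarrow> 'a::field vec set \<Rightarrow> 'a mat \<Rightarrow> bool" where
  "row_basis n W B \<longleftrightarrow> dim_col B = n \<and> bij_betw (\<lambda>c. c \<odot>\<^sub>r B) (carrier_vec (dim_row B)) W"

lemma add_eq_self_vec:
  fixes u v :: "'a::field vec"
  assumes "u = u + v" "u \<in> carrier_vec n" "v \<in> carrier_vec n"
  shows "v = 0\<^sub>v n"
proof (rule eq_vecI)
  fix j assume "j < dim_vec (0\<^sub>v n :: 'a vec)"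
  then have "u $ j = u $ j + v $ j" using assms by (metis carrier_vecD index_add_vec(1) index_zero_vec(2))
  then show "v $ j = 0\<^sub>v n $ j" using \<open>j < _\<close> by simp
qed (use assms in simp)

text \<open>A cyclic subspace is annihilated as soon as its generator is, because polynomials in \<open>A\<close>
  commute.\<close>

lemma poly_act_eq_0_on_cyclic:
  fixes A :: "'a::field mat"
  assumes A: "A \<in> carrier_mat n n" and w: "w \<in> carrier_vec n"
    and "w \<odot>\<^sub>r poly_mat q A = 0\<^sub>v n"
  shows "annihilates_on n A (cyclic_span A w) q"
  unfolding annihilates_on_def
proof
  fix v assume "v \<in> cyclic_span A w"
  then obtain p where v: "v = w \<odot>\<^sub>r poly_mat p A" by (auto simp: cyclic_span_def)
  have "v \<odot>\<^sub>r poly_mat q A = w \<odot>\<^sub>r poly_mat (q * p) A"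
    using A w by (simp add: v poly_act_mult[symmetric] mult.commute)
  also have "\<dots> = 0\<^sub>v n"
    using assms by (simp add: poly_act_mult poly_mat_carrier[OF A])
  finally show "v \<odot>\<^sub>r poly_mat q A = 0\<^sub>v n" .
qed

definition graded_rows :: "'a::field mat \<Rightarrow> 'a vec \<Rightarrow> nat \<Rightarrow> (nat \<Rightarrow> 'a poly) \<Rightarrow> 'a mat" where
  "graded_rows A w N g = mat_of_rows (dim_row A) (map (\<lambda>k. w \<odot>\<^sub>r poly_mat (g k) A) [0..<N])"

lemma graded_rows_carrier:
  "A \<in> carrier_mat n n \<Longrightarrow> graded_rows A w N g \<in> carrier_mat N n"
  by (simp add: graded_rows_def mat_of_rows_def)

lemma row_graded_rows:
  assumes A: "A \<in> carrier_mat n n" and "k < N"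
  shows "row (graded_rows A w N g) k = w \<odot>\<^sub>r poly_mat (g k) A"
  using assms row_act_carrier[OF poly_mat_carrier[OF A, of "g k"], of w]
  by (auto simp: graded_rows_def)

text \<open>Coordinates with respect to these rows are coordinates of polynomials with respect to \<open>g\<close>.\<close>

lemma row_act_graded_rows:
  fixes A :: "'a::field mat"
  assumes A: "A \<in> carrier_mat n n" and w: "w \<in> carrier_vec n" and c: "c \<in> carrier_vec N"
  shows "c \<odot>\<^sub>r graded_rows A w N g = w \<odot>\<^sub>r poly_mat (\<Sum>k<N. Polynomial.smult (c $ k) (g k)) A"
    (is "_ = ?rhs")
proof (rule eq_vecI)
  note B = graded_rows_carrier[OF A, of w N g]
  have dim: "dim_vec ?rhs = n"
    using poly_act_carrier[OF A] by (rule carrier_vecD)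
  then show "dim_vec (c \<odot>\<^sub>r graded_rows A w N g) = dim_vec ?rhs"
    using row_act_carrier[OF B, of c] by simp
  fix j assume "j < dim_vec ?rhs"
  then have j: "j < n" using dim by simp
  have "graded_rows A w N g $$ (k, j) = (w \<odot>\<^sub>r poly_mat (g k) A) $ j" if "k < N" for k
    using that B j row_graded_rows[OF A that, of w g] by (metis carrier_matD index_row(1))
  then show "(c \<odot>\<^sub>r graded_rows A w N g) $ j = ?rhs $ j"
    by (simp add: row_act_index[OF B c j] poly_act_sum_index[OF A w j])
qed

text \<open>The map \<open>q \<mapsto> w q(A)\<close> identifies \<open>F[X]/(f)\<close> with the cyclic subspace: reducing modulo the
  minimal polynomial \<open>f\<close> does not change \<open>w q(A)\<close>, and a non-zero \<open>q\<close> of degree below that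
  of \<open>f\<close> cannot annihilate \<open>w\<close>. Hence a basis of the polynomials of degree below
  \<open>degree f\<close> becomes a basis of the subspace. Any family with one polynomial of each degree
  will do; the powers of \<open>X\<close> would give the companion matrix of \<open>f\<close>.\<close>

lemma cyclic_row_basis:
  fixes A :: "'a::field mat"
  assumes A: "A \<in> carrier_mat n n" and w: "w \<in> carrier_vec n"
    and f: "is_min_poly_on n A (cyclic_span A w) f"
    and g: "\<And>k. k < degree f \<Longrightarrow> g k \<noteq> 0 \<and> degree (g k) = k"
  shows "row_basis n (cyclic_span A w) (graded_rows A w (degree f) g)"
proof -
  define N where "N = degree f"
  define B where "B = graded_rows A w N g"
  let ?comb = "\<lambda>c. \<Sum>k<N. Polynomial.smult (c k) (g k)"
  note B = graded_rows_carrier[OF A, of w N g, folded B_def]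
  note act = row_act_graded_rows[OF A w, of _ N g, folded B_def]
  have "f \<noteq> 0" using f by (auto simp: is_min_poly_on_def)
  have "inj_on (\<lambda>c. c \<odot>\<^sub>r B) (carrier_vec N)"
  proof (rule inj_onI)
    fix c d assume cd: "c \<in> carrier_vec N" "d \<in> carrier_vec N" "c \<odot>\<^sub>r B = d \<odot>\<^sub>r B"
    define h where "h = ?comb (\<lambda>k. c $ k - d $ k)"
    have "?comb (($) c) = ?comb (($) d) + h"
      by (simp add: h_def sum.distrib[symmetric] smult_diff_left)
    then have "c \<odot>\<^sub>r B = d \<odot>\<^sub>r B + w \<odot>\<^sub>r poly_mat h A"
      by (simp only: act[OF cd(1)] act[OF cd(2)] poly_act_add[OF A w])
    then have "d \<odot>\<^sub>r B = d \<odot>\<^sub>r B + w \<odot>\<^sub>r poly_mat h A" by (simp only: cd(3))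
    from add_eq_self_vec[OF this row_act_carrier[OF B] poly_act_carrier[OF A]]
    have "w \<odot>\<^sub>r poly_mat h A = 0\<^sub>v n" .
    then have "annihilates_on n A (cyclic_span A w) h"
      by (rule poly_act_eq_0_on_cyclic[OF A w])
    then have "h = 0 \<or> N \<le> degree h"
      using f by (auto simp: is_min_poly_on_def N_def)
    moreover have "coeff h j = 0" if "N \<le> j" for j
      unfolding h_def by (rule graded_polys_coeff) (use g that in \<open>auto simp: N_def\<close>)
    ultimately have "h = 0" by (metis leading_coeff_0_iff)
    then have "c $ k = d $ k" if "k < N" for k
      using graded_polys_independent[of N g "\<lambda>k. c $ k - d $ k" k] g that
      by (simp add: h_def N_def)
    then show "c = d" using cd by (intro eq_vecI) auto
  qed
  moreover have "(\<lambda>c. c \<odot>\<^sub>r B) ` carrier_vec N = cyclic_span A w"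
  proof (intro equalityI subsetI)
    fix v assume "v \<in> (\<lambda>c. c \<odot>\<^sub>r B) ` carrier_vec N"
    then show "v \<in> cyclic_span A w" by (auto simp: act cyclic_span_def)
  next
    fix v assume "v \<in> cyclic_span A w"
    then obtain q where v: "v = w \<odot>\<^sub>r poly_mat q A" by (auto simp: cyclic_span_def)
    have "w \<in> cyclic_span A w"
      unfolding cyclic_span_def by (intro CollectI exI[of _ 1]) (simp add: poly_act_1[OF A w])
    then have wf: "w \<odot>\<^sub>r poly_mat f A = 0\<^sub>v n"
      using f by (auto simp: is_min_poly_on_def annihilates_on_def)
    have "v = w \<odot>\<^sub>r poly_mat (f * (q div f) + q mod f) A" by (simp add: v)
    also have "\<dots> = w \<odot>\<^sub>r poly_mat (q mod f) A"
      by (simp only: poly_act_add[OF A w] poly_act_mult[OF A w] wf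
        row_act_zero_vec[OF poly_mat_carrier[OF A]] left_zero_vec[OF poly_act_carrier[OF A]])
    finally have v': "v = w \<odot>\<^sub>r poly_mat (q mod f) A" .
    have "coeff (q mod f) k = 0" if "N \<le> k" for k
      using that degree_mod_less[OF \<open>f \<noteq> 0\<close>, of q] by (auto simp: N_def coeff_eq_0)
    then obtain c where c: "q mod f = ?comb c"
      using graded_polys_span[of N g "q mod f"] g N_def by blast
    have "?comb c = ?comb (($) (vec N c))" by simp
    then have "v = vec N c \<odot>\<^sub>r B" using v' c by (simp only: act vec_carrier)
    then show "v \<in> (\<lambda>c. c \<odot>\<^sub>r B) ` carrier_vec N" by (simp add: image_iff) (metis vec_carrier)
  qed
  ultimately show ?thesis
    using B by (auto simp: row_basis_def bij_betw_def B_def N_def)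
qed

section \<open>The matrix of a primary cyclic subspace\<close>

text \<open>The polynomials \<open>p\<^sup>a X\<^sup>t\<close> with \<open>t < degree p\<close>, ordered by degree. Consecutive ones differ by
  the factor \<open>X\<close>, except that at the end of a block \<open>X\<^sup>d\<close> is replaced by \<open>p\<close>.\<close>

definition jordan_poly :: "'a::field poly \<Rightarrow> nat \<Rightarrow> 'a poly" where
  "jordan_poly p k = p ^ (k div degree p) * monom 1 (k mod degree p)"

lemma jordan_poly_degree:
  assumes "p \<noteq> 0"
  shows "jordan_poly p k \<noteq> 0" "degree (jordan_poly p k) = k"
proof -
  show "jordan_poly p k \<noteq> 0" using assms by (simp add: jordan_poly_def)
  show "degree (jordan_poly p k) = k"
    using assms by (simp add: jordan_poly_def degree_mult_eq degree_power_eq degree_monom_eq)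
qed

text \<open>The ones of the companion blocks and the ones of the corner blocks form a single
  superdiagonal without gaps; apart from it, only the last row of each diagonal block is
  non-zero. In this form a row of the matrix reads off one multiplication by \<open>X\<close>.\<close>

lemma jordan_block_of_index:
  assumes "i < m * degree p" "j < m * degree p"
  shows "jordan_block_of p m $$ (i, j) =
    (if j = Suc i then 1 else 0) +
    (if Suc i mod degree p = 0 \<and> j div degree p = i div degree p then - coeff p (j mod degree p) else 0)"
proof -
  define d where "d = degree p"
  have d: "d > 0" using assms by (cases "degree p") (auto simp: d_def)
  have md: "i mod d < d" "j mod d < d" using d by auto
  have "jordan_block_of p m $$ (i, j) =
    (if j div d = i div d
     then if i mod d = d - 1 then - coeff p (j mod d) else if j mod d = i mod d + 1 then 1 else 0
     else if j div d = i div d + 1 \<and> i mod d = d - 1 \<and> j mod d = 0 then 1 else 0)"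
    using assms md by (simp add: jordan_block_of_def companion_mat_def corner_mat_def Let_def d_def)
  moreover have "j = Suc i \<longleftrightarrow> j div d = Suc i div d \<and> j mod d = Suc i mod d"
    by (metis div_mult_mod_eq)
  moreover have "if i mod d = d - 1 then Suc i mod d = 0 \<and> Suc i div d = i div d + 1
    else Suc i mod d = Suc (i mod d) \<and> Suc i div d = i div d"
    using md d by (auto simp: div_Suc mod_Suc)
  ultimately show ?thesis
    unfolding d_def[symmetric] by (cases "i mod d = d - 1") simp_all
qed

text \<open>Inside a block, multiplication by \<open>X\<close> is a shift. At its end it produces \<open>p\<^sup>a X\<^sup>d\<close>, and
  \<open>X\<^sup>d\<close> is \<open>p\<close> minus the lower terms of \<open>p\<close>: the term \<open>p\<^sup>a p\<close> starts the next block and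
  the lower terms stay in the current one.\<close>

lemma X_mult_jordan_poly:
  assumes "lead_coeff p = 1" and d: "degree p > 0"
  shows "pCons 0 (jordan_poly p k) = jordan_poly p (Suc k) +
    (if Suc k mod degree p = 0
     then \<Sum>t<degree p. Polynomial.smult (- coeff p t) (jordan_poly p (degree p * (k div degree p) + t)) else 0)"
proof -
  define a where "a = k div degree p"
  let ?d = "degree p"
  have X: "pCons 0 (jordan_poly p k) = p ^ a * monom 1 (Suc (k mod ?d))"
    by (simp add: jordan_poly_def a_def monom_Suc)
  show ?thesis
  proof (cases "Suc k mod ?d = 0")
    case False
    then show ?thesis
      using X d by (simp add: jordan_poly_def div_Suc mod_Suc a_def split: if_splits)
  next
    case True
    then have k: "Suc (k mod ?d) = ?d" using d by (simp add: mod_Suc split: if_splits)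
    have "(\<Sum>t<?d. Polynomial.smult (- coeff p t) (jordan_poly p (?d * a + t))) =
      (\<Sum>t<?d. p ^ a * - monom (coeff p t) t)"
    proof (intro sum.cong refl)
      fix t assume "t \<in> {..<?d}"
      have "Polynomial.smult (- coeff p t) (p ^ a * monom 1 t) = p ^ a * - monom (coeff p t) t"
        by (metis mult_smult_right smult_monom minus_monom mult.right_neutral)
      then show "Polynomial.smult (- coeff p t) (jordan_poly p (?d * a + t)) = p ^ a * - monom (coeff p t) t"
        using d \<open>t \<in> _\<close> by (simp add: jordan_poly_def)
    qed
    also have "\<dots> = p ^ a * - (\<Sum>t<?d. monom (coeff p t) t)"
      by (simp add: sum_distrib_left sum_negf)
    finally have low: "(\<Sum>t<?d. Polynomial.smult (- coeff p t) (jordan_poly p (?d * a + t))) =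
      p ^ a * - (\<Sum>t<?d. monom (coeff p t) t)" .
    have "p = (\<Sum>t\<le>?d. monom (coeff p t) t)" by (rule poly_as_sum_of_monoms[symmetric])
    then have "p = (\<Sum>t<?d. monom (coeff p t) t) + monom 1 ?d"
      using assms by (simp add: lessThan_Suc_atMost[symmetric])
    then have "monom 1 ?d = p - (\<Sum>t<?d. monom (coeff p t) t)" by (metis add_diff_cancel_left')
    then have "pCons 0 (jordan_poly p k) = p ^ a * p + p ^ a * - (\<Sum>t<?d. monom (coeff p t) t)"
      using X k by (simp add: right_diff_distrib)
    moreover have "jordan_poly p (Suc k) = p ^ a * p"
      using k True by (simp add: jordan_poly_def div_Suc a_def)
    ultimately show ?thesis
      using True low by (simp add: a_def)
  qed
qed

text \<open>The exceptional term \<open>p\<^sup>m\<close> belongs to a row after the last one; it acts as zero on a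
  subspace with minimal polynomial \<open>p\<^sup>m\<close>.\<close>

lemma X_mult_jordan_poly_block:
  assumes p: "lead_coeff p = 1" and d: "degree p > 0" and k: "k < m * degree p"
  shows "pCons 0 (jordan_poly p k) =
    (\<Sum>j<m * degree p. Polynomial.smult (jordan_block_of p m $$ (k, j)) (jordan_poly p j)) +
    (if Suc k = m * degree p then p ^ m else 0)"
proof -
  let ?d = "degree p"
  define a where "a = k div ?d"
  have am: "a < m" using k d by (simp add: a_def less_mult_imp_div_less)
  let ?last = "\<lambda>j. if Suc k mod ?d = 0 \<and> j div ?d = a then - coeff p (j mod ?d) else 0"
  have "(\<Sum>j<m * ?d. Polynomial.smult (jordan_block_of p m $$ (k, j)) (jordan_poly p j)) =
    (\<Sum>j<m * ?d. if j = Suc k then jordan_poly p j else 0) +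
    (\<Sum>j<m * ?d. Polynomial.smult (?last j) (jordan_poly p j))"
    unfolding sum.distrib[symmetric]
    by (intro sum.cong) (auto simp: jordan_block_of_index k a_def Polynomial.smult_diff_left)
  \<comment> \<open>Only the columns \<open>d a, \<dots>, d a + d - 1\<close> of the current block contribute.\<close>
  also have "(\<Sum>j<m * ?d. Polynomial.smult (?last j) (jordan_poly p j)) =
    (\<Sum>t<?d. Polynomial.smult (?last (t + ?d * a)) (jordan_poly p (t + ?d * a)))"
  proof (rule sum.mono_neutral_cong_right[THEN trans])
    show "{?d * a..<?d * a + ?d} \<subseteq> {..<m * ?d}"
    proof -
      have "Suc a * ?d \<le> m * ?d" using am by (intro mult_right_mono) auto
      then show ?thesis by (auto simp: algebra_simps)
    qed
    show "\<forall>j\<in>{..<m * ?d} - {?d * a..<?d * a + ?d}. Polynomial.smult (?last j) (jordan_poly p j) = 0"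
    proof
      fix j assume "j \<in> {..<m * ?d} - {?d * a..<?d * a + ?d}"
      moreover have "j = ?d * (j div ?d) + j mod ?d" "j mod ?d < ?d" using d by simp_all
      ultimately have "j div ?d \<noteq> a" by (metis DiffE add_less_cancel_left atLeastLessThan_iff le_add1)
      then show "Polynomial.smult (?last j) (jordan_poly p j) = 0" by simp
    qed
    show "(\<Sum>j\<in>{?d * a..<?d * a + ?d}. Polynomial.smult (?last j) (jordan_poly p j)) =
      (\<Sum>t<?d. Polynomial.smult (?last (t + ?d * a)) (jordan_poly p (t + ?d * a)))"
      using sum.shift_bounds_nat_ivl[of "\<lambda>j. Polynomial.smult (?last j) (jordan_poly p j)" 0 "?d * a" ?d]
      by (simp add: atLeast0LessThan add.commute[of ?d "?d * a"])
  qed auto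
  also have "\<dots> = (if Suc k mod ?d = 0
     then \<Sum>t<?d. Polynomial.smult (- coeff p t) (jordan_poly p (?d * a + t)) else 0)"
    using d by (auto intro!: sum.cong simp: add.commute)
  also have "(\<Sum>j<m * ?d. if j = Suc k then jordan_poly p j else 0) =
    jordan_poly p (Suc k) - (if Suc k = m * ?d then p ^ m else 0)"
  proof (cases "Suc k = m * ?d")
    case True
    moreover have "jordan_poly p (m * ?d) = p ^ m" using d by (simp add: jordan_poly_def)
    ultimately show ?thesis by (auto intro!: sum.neutral)
  qed (use k in auto)
  finally show ?thesis
    using X_mult_jordan_poly[OF p d, of k] by (simp add: a_def)
qed

lemma jordan_block_of_carrier: "jordan_block_of p m \<in> carrier_mat (m * degree p) (m * degree p)"
  by (simp add: jordan_block_of_def Let_def)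

lemma graded_rows_jordan_block:
  fixes A :: "'a::field mat"
  assumes A: "A \<in> carrier_mat n n" and w: "w \<in> carrier_vec n"
    and p: "lead_coeff p = 1" "degree p > 0"
    and ann: "w \<odot>\<^sub>r poly_mat (p ^ m) A = 0\<^sub>v n"
  defines "B \<equiv> graded_rows A w (m * degree p) (jordan_poly p)"
  shows "B * A = jordan_block_of p m * B"
proof (rule eq_rowI)
  let ?N = "m * degree p"
  note B = graded_rows_carrier[OF A, of w ?N "jordan_poly p", folded B_def]
  note J = jordan_block_of_carrier[of p m]
  show "dim_row (B * A) = dim_row (jordan_block_of p m * B)"
    "dim_col (B * A) = dim_col (jordan_block_of p m * B)"
    using A B J by auto
  fix k assume "k < dim_row (jordan_block_of p m * B)"
  then have k: "k < ?N" using J by auto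
  let ?q = "\<Sum>j<?N. Polynomial.smult (jordan_block_of p m $$ (k, j)) (jordan_poly p j)"
  have "row (B * A) k = (w \<odot>\<^sub>r poly_mat (jordan_poly p k) A) \<odot>\<^sub>r A"
    using k by (simp add: row_mult_row_act[OF B A]) (simp add: B_def row_graded_rows[OF A])
  also have "\<dots> = w \<odot>\<^sub>r poly_mat (?q + (if Suc k = ?N then p ^ m else 0)) A"
    using X_mult_jordan_poly_block[OF p k] poly_act_mult_X[OF A w] by metis
  also have "\<dots> = w \<odot>\<^sub>r poly_mat ?q A + 0\<^sub>v n"
    using ann by (simp add: poly_act_add[OF A w] poly_act_0[OF A w])
  also have "\<dots> = w \<odot>\<^sub>r poly_mat ?q A"
    by (intro right_zero_vec poly_act_carrier[OF A])
  also have "?q = (\<Sum>j<?N. Polynomial.smult (row (jordan_block_of p m) k $ j) (jordan_poly p j))"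
    using J k by (intro sum.cong) auto
  also have "w \<odot>\<^sub>r poly_mat \<dots> A = row (jordan_block_of p m) k \<odot>\<^sub>r B"
    using row_carrier_vec[OF k J] unfolding B_def by (rule row_act_graded_rows[OF A w, symmetric])
  also have "\<dots> = row (jordan_block_of p m * B) k"
    using k by (simp add: row_mult_row_act[OF J B])
  finally show "row (B * A) k = row (jordan_block_of p m * B) k" .
qed

section \<open>Stacking bases of the summands of a direct sum\<close>

definition stack_rows :: "nat \<Rightarrow> 'a::zero mat list \<Rightarrow> 'a mat" where
  "stack_rows n Bs = foldr (@\<^sub>r) Bs (0\<^sub>m 0 n)"

lemma stack_rows_carrier:
  "\<forall>B\<in>set Bs. dim_col B = n \<Longrightarrow> stack_rows n Bs \<in> carrier_mat (sum_list (map dim_row Bs)) n"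
proof (induction Bs)
  case Nil
  show ?case by (simp add: stack_rows_def)
next
  case (Cons B Bs)
  have "B \<in> carrier_mat (dim_row B) n" using Cons.prems by (intro carrier_matI) simp_all
  moreover have "stack_rows n Bs \<in> carrier_mat (sum_list (map dim_row Bs)) n"
    using Cons.prems by (intro Cons.IH) simp
  ultimately have "B @\<^sub>r stack_rows n Bs \<in> carrier_mat (dim_row B + sum_list (map dim_row Bs)) n"
    by (rule carrier_append_rows)
  then show ?case by (simp only: stack_rows_def foldr.simps o_apply list.map sum_list.Cons)
qed

lemma row_act_append_rows:
  fixes B C :: "'a::field mat"
  assumes B: "B \<in> carrier_mat k n" and C: "C \<in> carrier_mat l n"
    and c: "c \<in> carrier_vec (k + l)"
  shows "c \<odot>\<^sub>r (B @\<^sub>r C) = vec_first c k \<odot>\<^sub>r B + vec_last c l \<odot>\<^sub>r C"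
proof (rule eq_vecI)
  note BC = carrier_append_rows[OF B C]
  show "dim_vec (c \<odot>\<^sub>r (B @\<^sub>r C)) = dim_vec (vec_first c k \<odot>\<^sub>r B + vec_last c l \<odot>\<^sub>r C)"
    using BC C by (simp add: row_act_def)
  fix j assume "j < dim_vec (vec_first c k \<odot>\<^sub>r B + vec_last c l \<odot>\<^sub>r C)"
  then have j: "j < n" using C by (simp add: row_act_def)
  have "col (B @\<^sub>r C) j = col B j @\<^sub>v col C j"
    using B C j unfolding append_rows_def
    by (subst col_four_block_mat[of _ k n _ 0 _ l]) auto
  then have "(vec_first c k @\<^sub>v vec_last c l) \<bullet> col (B @\<^sub>r C) j =
      vec_first c k \<bullet> col B j + vec_last c l \<bullet> col C j"
    using B C j scalar_prod_append[of "vec_first c k" k "vec_last c l" l "col B j" "col C j"] by simp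
  then show "(c \<odot>\<^sub>r (B @\<^sub>r C)) $ j = (vec_first c k \<odot>\<^sub>r B + vec_last c l \<odot>\<^sub>r C) $ j"
    using BC B C j c carrier_matD(2)[OF BC] by (simp add: row_act_def)
qed

lemma append_rows_mult:
  fixes B C :: "'a::field mat"
  assumes B: "B \<in> carrier_mat k n" and C: "C \<in> carrier_mat l n" and A: "A \<in> carrier_mat n m"
  shows "(B @\<^sub>r C) * A = (B * A) @\<^sub>r (C * A)"
proof -
  have "four_block_mat A (0\<^sub>m n 0) (0\<^sub>m 0 m) (0\<^sub>m 0 0) = A" using A by (intro eq_matI) auto
  then have "(B @\<^sub>r C) * A =
      four_block_mat B (0\<^sub>m k 0) C (0\<^sub>m l 0) * four_block_mat A (0\<^sub>m n 0) (0\<^sub>m 0 m) (0\<^sub>m 0 0)"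
    using B C by (simp add: append_rows_def)
  also have "\<dots> = (B * A) @\<^sub>r (C * A)"
    using B C A by (subst mult_four_block_mat[of _ k n _ 0 _ l]) (auto simp: append_rows_def)
  finally show ?thesis .
qed

lemma block_diag_mult_append_rows:
  fixes B C :: "'a::field mat"
  assumes B: "B \<in> carrier_mat k n" and C: "C \<in> carrier_mat l n"
    and J: "J \<in> carrier_mat k k" and D: "D \<in> carrier_mat l l"
  shows "four_block_mat J (0\<^sub>m k l) (0\<^sub>m l k) D * (B @\<^sub>r C) = (J * B) @\<^sub>r (D * C)"
proof -
  have "four_block_mat J (0\<^sub>m k l) (0\<^sub>m l k) D * four_block_mat B (0\<^sub>m k 0) C (0\<^sub>m l 0) =
    (J * B) @\<^sub>r (D * C)"
    using assms by (subst mult_four_block_mat[of _ k k _ l _ l]) (auto simp: append_rows_def)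
  then show ?thesis using B C by (simp add: append_rows_def)
qed

text \<open>Written as \<open>B A = J B\<close>, the equation for the matrix of \<open>A\<close> makes sense for the basis of a
  single summand, where \<open>B\<close> is not square. It passes to stacked rows block by block, and
  the inverse of \<open>B\<close> is needed only once, for the whole space.\<close>

lemma stack_rows_intertwines:
  fixes A :: "'a::field mat"
  assumes A: "A \<in> carrier_mat n n"
    and "list_all2 (\<lambda>B J. dim_col B = n \<and> J \<in> carrier_mat (dim_row B) (dim_row B) \<and> B * A = J * B) Bs Js"
  shows "stack_rows n Bs * A = diag_block_mat Js * stack_rows n Bs \<and>
    diag_block_mat Js \<in> carrier_mat (sum_list (map dim_row Bs)) (sum_list (map dim_row Bs))"
  using assms(2)
proof (induction rule: list_all2_induct)
  case Nil
  have "0\<^sub>m 0 n * A = 0\<^sub>m 0 0 * 0\<^sub>m 0 n" using A by (intro eq_matI) simp_all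
  then show ?case by (simp add: stack_rows_def)
next
  case (Cons B Bs J Js)
  let ?k = "dim_row B" and ?l = "sum_list (map dim_row Bs)" and ?S = "stack_rows n Bs"
  let ?D = "diag_block_mat Js"
  have B: "B \<in> carrier_mat ?k n" using Cons.hyps(1) by auto
  have S: "?S \<in> carrier_mat ?l n"
  proof (rule stack_rows_carrier)
    show "\<forall>B\<in>set Bs. dim_col B = n"
    proof
      fix C assume "C \<in> set Bs"
      then obtain i where i: "i < length Bs" "C = Bs ! i" by (auto simp: in_set_conv_nth)
      show "dim_col C = n"
        unfolding i(2) by (rule list_all2_nthD[OF Cons.hyps(2) i(1), THEN conjunct1])
    qed
  qed
  have J: "J \<in> carrier_mat ?k ?k" and D: "?D \<in> carrier_mat ?l ?l"
    using Cons.hyps(1) Cons.IH by blast+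
  have diag: "diag_block_mat (J # Js) = four_block_mat J (0\<^sub>m ?k ?l) (0\<^sub>m ?l ?k) ?D"
    using carrier_matD[OF J] carrier_matD[OF D] by (simp add: Let_def)
  have "stack_rows n (B # Bs) * A = (B * A) @\<^sub>r (?S * A)"
    using append_rows_mult[OF B S A] by (simp only: stack_rows_def foldr.simps o_apply)
  also have "\<dots> = (J * B) @\<^sub>r (?D * ?S)"
    using Cons.hyps(1) Cons.IH by (simp only:)
  also have "\<dots> = diag_block_mat (J # Js) * stack_rows n (B # Bs)"
    unfolding diag block_diag_mult_append_rows[OF B S J D, symmetric]
    by (simp only: stack_rows_def foldr.simps o_apply)
  finally have "stack_rows n (B # Bs) * A = diag_block_mat (J # Js) * stack_rows n (B # Bs)" .
  moreover have "diag_block_mat (J # Js) \<in> carrier_mat (?k + ?l) (?k + ?l)"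
    unfolding diag using J D by (rule four_block_carrier_mat)
  ultimately show ?case by (simp only: list.map sum_list.Cons)
qed

text \<open>The components in the single summands of the vector with coordinates \<open>c\<close> in the stacked
  basis: \<open>stack_rows\<close> alone only sees their sum, and these components are what a direct sum
  makes unique.\<close>

fun block_acts :: "'a::semiring_0 mat list \<Rightarrow> 'a vec \<Rightarrow> 'a vec list" where
  "block_acts [] c = []"
| "block_acts (B # Bs) c = (vec_first c (dim_row B) \<odot>\<^sub>r B) #
     block_acts Bs (vec_last c (sum_list (map dim_row Bs)))"

lemma block_acts_bij:
  fixes Bs :: "'a::field mat list"
  assumes "list_all2 (row_basis n) Ws Bs"
  shows "bij_betw (block_acts Bs) (carrier_vec (sum_list (map dim_row Bs))) {ws. list_all2 (\<in>) ws Ws}"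
  using assms
proof (induction rule: list_all2_induct)
  case Nil
  have "c = 0\<^sub>v 0" if "c \<in> carrier_vec 0" for c :: "'a vec" using that by auto
  then show ?case by (auto simp: bij_betw_def inj_on_def intro!: image_eqI[of _ _ "0\<^sub>v 0"])
next
  case (Cons W Ws B Bs)
  let ?k = "dim_row B" and ?l = "sum_list (map dim_row Bs)"
  have B: "bij_betw (\<lambda>c. c \<odot>\<^sub>r B) (carrier_vec ?k) W" using Cons by (simp add: row_basis_def)
  note IH = Cons.IH
  show ?case
  proof (rule bij_betw_imageI)
    show "inj_on (block_acts (B # Bs)) (carrier_vec (sum_list (map dim_row (B # Bs))))"
    proof (rule inj_onI)
      fix c d assume cd: "c \<in> carrier_vec (sum_list (map dim_row (B # Bs)))"
        "d \<in> carrier_vec (sum_list (map dim_row (B # Bs)))"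
        "block_acts (B # Bs) c = block_acts (B # Bs) d"
      then have "vec_first c ?k \<odot>\<^sub>r B = vec_first d ?k \<odot>\<^sub>r B"
        and "block_acts Bs (vec_last c ?l) = block_acts Bs (vec_last d ?l)" by simp_all
      then have "vec_first c ?k = vec_first d ?k" "vec_last c ?l = vec_last d ?l"
        using inj_onD[OF bij_betw_imp_inj_on[OF B]] inj_onD[OF bij_betw_imp_inj_on[OF IH]]
        by (meson vec_first_carrier vec_last_carrier)+
      moreover have "vec_first c ?k @\<^sub>v vec_last c ?l = c" "vec_first d ?k @\<^sub>v vec_last d ?l = d"
        using cd by (auto intro!: vec_first_last_append)
      ultimately show "c = d" by metis
    qed
    show "block_acts (B # Bs) ` carrier_vec (sum_list (map dim_row (B # Bs))) =
      {ws. list_all2 (\<in>) ws (W # Ws)}"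
    proof (intro equalityI subsetI)
      fix ws assume "ws \<in> block_acts (B # Bs) ` carrier_vec (sum_list (map dim_row (B # Bs)))"
      then show "ws \<in> {ws. list_all2 (\<in>) ws (W # Ws)}"
        by (auto intro!: bij_betw_apply[OF B] bij_betw_apply[OF IH, simplified])
    next
      fix ws assume "ws \<in> {ws. list_all2 (\<in>) ws (W # Ws)}"
      then obtain w vs where ws: "ws = w # vs" "w \<in> W" "list_all2 (\<in>) vs Ws"
        by (auto simp: list_all2_Cons2)
      obtain c where c: "c \<in> carrier_vec ?k" "c \<odot>\<^sub>r B = w"
        using bij_betw_imp_surj_on[OF B] ws by auto
      have "vs \<in> block_acts Bs ` carrier_vec ?l"
        using bij_betw_imp_surj_on[OF IH] ws by simp
      then obtain d where d: "d \<in> carrier_vec ?l" "block_acts Bs d = vs" by (auto elim!: imageE)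
      have "vec_first (c @\<^sub>v d) ?k = c" "vec_last (c @\<^sub>v d) ?l = d"
        using c d by (auto simp: vec_first_def vec_last_def)
      then have "block_acts (B # Bs) (c @\<^sub>v d) = ws" using c d ws by simp
      then show "ws \<in> block_acts (B # Bs) ` carrier_vec (sum_list (map dim_row (B # Bs)))"
        using c d by (intro image_eqI[of _ _ "c @\<^sub>v d"]) auto
    qed
  qed
qed

lemma finsum_vec_Cons:
  fixes w :: "'a::field vec"
  assumes "w \<in> carrier_vec n" "set ws \<subseteq> carrier_vec n"
  shows "finsum_vec TYPE('a) n ((!) (w # ws)) {..<length (w # ws)} =
    w + finsum_vec TYPE('a) n ((!) ws) {..<length ws}"
proof (rule eq_vecI)
  have c: "(!) ws \<in> {..<length ws} \<rightarrow> carrier_vec n" "(!) (w # ws) \<in> {..<length (w # ws)} \<rightarrow> carrier_vec n"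
    using assms by (auto simp: nth_Cons subset_iff split: nat.splits)
  show d: "dim_vec (finsum_vec TYPE('a) n ((!) (w # ws)) {..<length (w # ws)}) =
      dim_vec (w + finsum_vec TYPE('a) n ((!) ws) {..<length ws})"
    using finsum_vec_closed[OF c(1)] finsum_vec_closed[OF c(2)] by simp
  fix j assume "j < dim_vec (w + finsum_vec TYPE('a) n ((!) ws) {..<length ws})"
  then have "j < n" "j < dim_vec (finsum_vec TYPE('a) n ((!) ws) {..<length ws})"
    using finsum_vec_closed[OF c(1)] by auto
  then show "finsum_vec TYPE('a) n ((!) (w # ws)) {..<length (w # ws)} $ j =
      (w + finsum_vec TYPE('a) n ((!) ws) {..<length ws}) $ j"
    using index_finsum_vec[OF _ _ c(1)] index_finsum_vec[OF _ _ c(2)]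
    by (simp add: sum.lessThan_Suc_shift del: sum.lessThan_Suc)
qed

lemma sum_block_acts:
  fixes Bs :: "'a::field mat list"
  assumes "\<forall>B\<in>set Bs. dim_col B = n" and "c \<in> carrier_vec (sum_list (map dim_row Bs))"
  shows "finsum_vec TYPE('a) n ((!) (block_acts Bs c)) {..<length (block_acts Bs c)} = c \<odot>\<^sub>r stack_rows n Bs
    \<and> set (block_acts Bs c) \<subseteq> carrier_vec n"
  using assms
proof (induction Bs arbitrary: c)
  case Nil
  then show ?case by (auto simp: stack_rows_def finsum_vec_empty row_act_def scalar_prod_def intro!: eq_vecI)
next
  case (Cons B Bs)
  let ?k = "dim_row B" and ?l = "sum_list (map dim_row Bs)"
  have B: "B \<in> carrier_mat ?k n" using Cons.prems by auto
  have S: "stack_rows n Bs \<in> carrier_mat ?l n" using Cons.prems by (intro stack_rows_carrier) auto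
  have "c \<odot>\<^sub>r stack_rows n (B # Bs) = vec_first c ?k \<odot>\<^sub>r B + vec_last c ?l \<odot>\<^sub>r stack_rows n Bs"
    using row_act_append_rows[OF B S, of c] Cons.prems by (simp add: stack_rows_def)
  moreover have first: "vec_first c ?k \<odot>\<^sub>r B \<in> carrier_vec n" by (rule row_act_carrier[OF B])
  moreover have IH: "finsum_vec TYPE('a) n ((!) (block_acts Bs (vec_last c ?l)))
      {..<length (block_acts Bs (vec_last c ?l))} = vec_last c ?l \<odot>\<^sub>r stack_rows n Bs"
    "set (block_acts Bs (vec_last c ?l)) \<subseteq> carrier_vec n"
    using Cons.IH[of "vec_last c ?l"] Cons.prems(1) by simp_all
  ultimately show ?case
    unfolding block_acts.simps finsum_vec_Cons[OF first IH(2)] by simp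
qed

text \<open>Coordinates are unique in two stages: a vector determines its components in the summands,
  and each component determines its coordinates there. The composite of the two bijections is
  the linear combination of the stacked rows.\<close>

lemma direct_sum_row_basis:
  fixes Bs :: "'a::field mat list"
  assumes sum: "is_direct_sum n Ws" and bases: "list_all2 (row_basis n) Ws Bs"
  shows "row_basis n (carrier_vec n) (stack_rows n Bs)"
proof -
  define total :: "'a vec list \<Rightarrow> 'a vec"
    where "total = (\<lambda>ws. finsum_vec TYPE('a) n ((!) ws) {..<length Ws})"
  let ?Z = "{ws. list_all2 (\<in>) ws Ws}" and ?N = "sum_list (map dim_row Bs)"
  have cols: "\<forall>B\<in>set Bs. dim_col B = n"
    using bases by (auto simp: list_all2_conv_all_nth in_set_conv_nth row_basis_def)
  note S = stack_rows_carrier[OF cols]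
  note bij = block_acts_bij[OF bases]
  have act: "total (block_acts Bs c) = c \<odot>\<^sub>r stack_rows n Bs" if "c \<in> carrier_vec ?N" for c
  proof -
    have "length (block_acts Bs c) = length Ws"
      using bij_betwE[OF bij] that by (blast dest: list_all2_lengthD)
    then show ?thesis using sum_block_acts[OF cols that] by (simp add: total_def)
  qed
  have closed: "total ws \<in> carrier_vec n" if "ws \<in> ?Z" for ws
    using that bij_betw_imp_surj_on[OF bij] act row_act_carrier[OF S] by (metis imageE)
  have uniq: "\<exists>!ws. ws \<in> ?Z \<and> v = total ws" if "v \<in> carrier_vec n" for v
    using sum that by (simp add: is_direct_sum_def total_def)
  have "bij_betw total ?Z (carrier_vec n)"
  proof (rule bij_betw_imageI)
    show "inj_on total ?Z"
    proof (rule inj_onI)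
      fix ws vs assume "ws \<in> ?Z" "vs \<in> ?Z" "total ws = total vs"
      then show "ws = vs" using uniq[OF closed[of ws]] by blast
    qed
    show "total ` ?Z = carrier_vec n"
    proof (intro equalityI subsetI)
      fix v :: "'a vec" assume "v \<in> carrier_vec n"
      then show "v \<in> total ` ?Z" using uniq by blast
    qed (use closed in blast)
  qed
  from bij_betw_trans[OF bij this]
  have "bij_betw (\<lambda>c. c \<odot>\<^sub>r stack_rows n Bs) (carrier_vec ?N) (carrier_vec n)"
    by (rule bij_betw_cong[THEN iffD1, rotated]) (simp add: act)
  then show ?thesis using S by (simp add: row_basis_def)
qed

section \<open>A basis of the whole space is an invertible matrix\<close>

text \<open>The coordinate map is a linear isomorphism onto the whole space. It preserves dimension, so
  \<open>B\<close> is square, and it carries the unit vectors to the rows of \<open>B\<close>.\<close>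

lemma row_basis_carrier_vec:
  fixes B :: "'a::field mat"
  assumes "row_basis n (carrier_vec n) B"
  shows "B \<in> carrier_mat n n" "distinct (rows B)" "is_basis n (set (rows B))"
proof -
  let ?N = "dim_row B"
  let ?T = "\<lambda>c. c \<odot>\<^sub>r B"
  interpret D: vec_space "TYPE('a)" ?N .
  interpret E: vec_space "TYPE('a)" n .
  have B: "B \<in> carrier_mat ?N n" and bij: "bij_betw ?T (carrier_vec ?N) (carrier_vec n)"
    using assms by (auto simp: row_basis_def)
  have "?T \<in> LinearCombinations.module_hom class_ring (module_vec TYPE('a) ?N) (module_vec TYPE('a) n)"
    unfolding LinearCombinations.module_hom_def module_vec_simps
    by (simp add: row_act_carrier[OF B] row_act_add[OF B] row_act_smult[OF B])
  then interpret T: linear_map class_ring "module_vec TYPE('a) ?N" "module_vec TYPE('a) n" ?T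
    by unfold_locales
  have inj: "inj_on ?T (carrier (module_vec TYPE('a) ?N))"
    and surj: "?T ` carrier (module_vec TYPE('a) ?N) = carrier (module_vec TYPE('a) n)"
    using bij by (auto simp: bij_betw_def module_vec_simps)
  have rows: "rows B = map ?T (unit_vecs ?N)"
    by (auto simp: rows_def unit_vecs_def unit_vec_row_act[OF B])
  show "is_basis n (set (rows B))"
    using T.linear_inj_image_is_basis[OF inj surj D.unit_vecs_basis D.fin_dim] by (simp add: rows)
  show "distinct (rows B)"
    unfolding rows using D.unit_vecs_distinct bij unit_vecs_carrier
    by (auto simp: distinct_map bij_betw_def intro: inj_on_subset)
  have "?N = n"
    using T.dim_eq[OF D.fin_dim inj surj] D.dim_is_n E.dim_is_n by simp
  then show "B \<in> carrier_mat n n" using carrier_matD(2)[OF B] by (rule carrier_matI)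
qed

text \<open>The rows of the inverse are the coordinates of the unit vectors.\<close>

lemma row_basis_carrier_vec_inverse:
  fixes B :: "'a::field mat"
  assumes "row_basis n (carrier_vec n) B"
  obtains C where "C \<in> carrier_mat n n" "B * C = 1\<^sub>m n" "C * B = 1\<^sub>m n"
proof -
  note B = row_basis_carrier_vec(1)[OF assms]
  have "\<forall>i<n. \<exists>c\<in>carrier_vec n. c \<odot>\<^sub>r B = unit_vec n i"
  proof (intro allI impI)
    fix i assume "i < n"
    have "(\<lambda>c. c \<odot>\<^sub>r B) ` carrier_vec n = carrier_vec n"
      using assms carrier_matD(1)[OF B] by (auto simp: row_basis_def bij_betw_def)
    then have "unit_vec n i \<in> (\<lambda>c. c \<odot>\<^sub>r B) ` carrier_vec n" by (simp only: unit_vec_carrier)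
    then show "\<exists>c\<in>carrier_vec n. c \<odot>\<^sub>r B = unit_vec n i" by (auto elim!: imageE)
  qed
  then obtain c where c: "\<And>i. i < n \<Longrightarrow> c i \<in> carrier_vec n \<and> c i \<odot>\<^sub>r B = unit_vec n i"
    by metis
  define C where "C = mat_of_rows n (map c [0..<n])"
  have C: "C \<in> carrier_mat n n" by (simp add: C_def mat_of_rows_def)
  have "C * B = 1\<^sub>m n"
  proof (rule eq_rowI)
    fix i assume "i < dim_row (1\<^sub>m n :: 'a mat)"
    then have i: "i < n" by simp
    have "row C i = c i" using i c[OF i] by (simp add: C_def)
    then show "row (C * B) i = row (1\<^sub>m n) i"
      using i c[OF i] by (simp add: row_mult_row_act[OF C B])
  qed (use B C in auto)
  then show thesis using that[OF C] mat_mult_left_right_inverse[OF C B] by blast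
qed

lemma basis_change:
  fixes A B C :: "'a::field mat"
  assumes B: "B \<in> carrier_mat n n" and C: "C \<in> carrier_mat n n"
    and BC: "B * C = 1\<^sub>m n" "C * B = 1\<^sub>m n"
  shows "B \<in> GL n" "mat_inv B = C" "mat_conj A (mat_inv B) = B * A * mat_inv B"
proof -
  interpret R: ring "ring_mat TYPE('a) n ()" by (rule ring_mat)
  show "B \<in> GL n" using B C BC by (auto simp: GL_def Units_def ring_mat_simps)
  have inv: "mat_inv X = Y" if "X \<in> carrier_mat n n" "Y \<in> carrier_mat n n" "X * Y = 1\<^sub>m n" "Y * X = 1\<^sub>m n"
    for X Y :: "'a mat"
    using R.inv_char[of X Y] that by (simp add: mat_inv_def ring_mat_simps)
  show "mat_inv B = C" using inv[OF B C] BC by simp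
  moreover have "mat_inv C = B" using inv[OF C B] BC by simp
  ultimately show "mat_conj A (mat_inv B) = B * A * mat_inv B" by (simp add: mat_conj_def)
qed

section \<open>The generalised Jordan form\<close>

text \<open>The difference of two monic candidates of the same degree would be an annihilator of
  smaller degree.\<close>

lemma is_min_poly_on_unique:
  assumes A: "A \<in> carrier_mat n n" and W: "W \<subseteq> carrier_vec n"
    and f: "is_min_poly_on n A W f" and g: "is_min_poly_on n A W g"
  shows "f = g"
proof (rule ccontr)
  assume "f \<noteq> g"
  have lc: "lead_coeff f = 1" "lead_coeff g = 1"
    using f g by (simp_all add: is_min_poly_on_def)
  then have "f \<noteq> 0" "g \<noteq> 0" by auto
  then have fg: "degree f = degree g"
    using f g by (intro antisym) (simp_all add: is_min_poly_on_def)
  have "w \<odot>\<^sub>r poly_mat (f - g) A = 0\<^sub>v n" if "w \<in> W" for w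
  proof -
    have w: "w \<in> carrier_vec n" using that W by auto
    have "w \<odot>\<^sub>r poly_mat (f + Polynomial.smult (- 1) g) A = 0\<^sub>v n"
      using f g that by (simp only: poly_act_add[OF A w] poly_act_smult[OF A w])
        (simp add: is_min_poly_on_def annihilates_on_def vec_eq_iff)
    then show ?thesis by simp
  qed
  then have "annihilates_on n A W (f - g)" by (simp add: annihilates_on_def)
  then have "degree f \<le> degree (f - g)" using f \<open>f \<noteq> g\<close> by (simp add: is_min_poly_on_def)
  moreover have "degree (f - g) \<le> degree f" using fg degree_diff_le_max[of f g] by simp
  ultimately have "coeff (f - g) (degree (f - g)) = 0" using fg lc by simp
  then show False using \<open>f \<noteq> g\<close> by (metis leading_coeff_0_iff right_minus_eq)
qed

text \<open>The irreducible polynomial that witnesses primariness need not be monic, although its power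
  is; dividing by the leading coefficient does not change that power. The exponent is positive
  because \<open>1\<close> annihilates only the zero subspace.\<close>

lemma primary_min_poly:
  fixes A :: "'a::field mat"
  assumes A: "A \<in> carrier_mat n n" and W: "W \<subseteq> carrier_vec n" "0\<^sub>v n \<in> W" "W \<noteq> {0\<^sub>v n}"
    and f: "is_min_poly_on n A W f" and "primary_on n A W"
  obtains p m where "lead_coeff p = 1" "irreducible p" "1 \<le> m" "f = p ^ m"
proof -
  obtain q m where q: "irreducible q" "is_min_poly_on n A W (q ^ m)"
    using assms by (auto simp: primary_on_def)
  have fq: "f = q ^ m" using is_min_poly_on_unique[OF A W(1) f q(2)] .
  define c where "c = inverse (lead_coeff q)"
  have "q \<noteq> 0" using q by auto
  then have c: "c \<noteq> 0" by (simp add: c_def)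
  have "lead_coeff q ^ m = 1" using f fq by (simp add: is_min_poly_on_def lead_coeff_power)
  then have "Polynomial.smult c q ^ m = f"
    by (simp add: smult_power c_def fq power_inverse)
  moreover have "m \<noteq> 0"
  proof
    assume "m = 0"
    then have "annihilates_on n A W 1" using f fq by (simp add: is_min_poly_on_def)
    have "\<forall>w\<in>W. w = 0\<^sub>v n"
    proof
      fix w assume "w \<in> W"
      then show "w = 0\<^sub>v n"
        using W(1) \<open>annihilates_on n A W 1\<close> poly_act_1[OF A, of w] by (auto simp: annihilates_on_def)
    qed
    then show False using W(2,3) by blast
  qed
  moreover have "irreducible (Polynomial.smult c q)"
  proof -
    have "is_unit [:c:]" using c by (simp add: is_unit_poly_iff dvd_field_iff)
    then show ?thesis using q irreducible_mult_unit_left[of "[:c:]" q] by simp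
  qed
  moreover have "lead_coeff (Polynomial.smult c q) = 1" using \<open>q \<noteq> 0\<close> by (simp add: c_def)
  ultimately show thesis using that[of "Polynomial.smult c q" m] by simp
qed

lemma cyclic_primary_jordan_basis:
  fixes A :: "'a::field mat"
  assumes A: "A \<in> carrier_mat n n" and W: "invariant_subspace n A W" "W \<noteq> {0\<^sub>v n}"
    "cyclic_subspace A W" "primary_on n A W" and f: "is_min_poly_on n A W f"
  obtains B where "row_basis n W B" "B * A = gen_jordan_block f * B"
    "gen_jordan_block f \<in> carrier_mat (dim_row B) (dim_row B)"
proof -
  have sub: "is_subspace n W" using W by (simp add: invariant_subspace_def)
  then have Wc: "W \<subseteq> carrier_vec n"
    by (auto simp: VectorSpace.subspace_def submodule_def module_vec_simps)
  obtain w where w: "w \<in> W" and span: "W = cyclic_span A w"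
    using W by (auto simp: cyclic_subspace_def)
  have wc: "w \<in> carrier_vec n" using w Wc by auto
  have "0\<^sub>v n \<in> W"
    unfolding span cyclic_span_def using poly_act_0[OF A wc] by (intro CollectI exI[of _ 0]) simp
  from primary_min_poly[OF A Wc this W(2) f W(4)]
  obtain p m where p: "lead_coeff p = 1" "irreducible p" "1 \<le> m" "f = p ^ m" .
  have p0: "p \<noteq> 0" using p by auto
  have deg: "degree p > 0"
    using p by (metis bot_nat_0.not_eq_extremum irreducible_def is_unit_iff_degree)
  have N: "degree f = m * degree p" using p0 p by (simp add: degree_power_eq)
  define B where "B = graded_rows A w (m * degree p) (jordan_poly p)"
  have J: "gen_jordan_block f = jordan_block_of p m"
    using gen_jordan_block_power[OF p(1-3)] p by simp
  have "row_basis n W B"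
    using cyclic_row_basis[OF A wc f[unfolded span], of "jordan_poly p"] jordan_poly_degree[OF p0]
    by (simp add: N span B_def)
  moreover have "B * A = gen_jordan_block f * B"
    unfolding J B_def using f w p(4)
    by (intro graded_rows_jordan_block[OF A wc p(1) deg])
      (simp add: is_min_poly_on_def annihilates_on_def)
  moreover have "gen_jordan_block f \<in> carrier_mat (dim_row B) (dim_row B)"
    using J jordan_block_of_carrier[of p m] graded_rows_carrier[OF A] by (metis B_def carrier_matD(1))
  ultimately show thesis using that by blast
qed

theorem theorem5p0p3:
  fixes n :: nat and A :: "'a::field mat" and fs :: "'a poly list"
  assumes "A \<in> carrier_mat n n"
    and "elementary_divisors n A fs"
  shows "\<exists>bs. distinct bs \<and> is_basis n (set bs) \<and>
    (let B = mat_of_rows n bs in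
       B \<in> GL n \<and>
       mat_conj A (mat_inv B) = B * A * mat_inv B \<and>
       B * A * mat_inv B = diag_block_mat (map gen_jordan_block fs))"
proof -
  note A = assms(1)
  obtain Ws where sum: "is_direct_sum n Ws"
    and Ws: "\<forall>W\<in>set Ws. invariant_subspace n A W \<and> W \<noteq> {0\<^sub>v n} \<and> cyclic_subspace A W \<and> primary_on n A W"
    and fs: "list_all2 (is_min_poly_on n A) Ws fs"
    using assms(2) by (auto simp: elementary_divisors_def)
  let ?good = "\<lambda>i B. row_basis n (Ws ! i) B \<and> B * A = gen_jordan_block (fs ! i) * B \<and>
    gen_jordan_block (fs ! i) \<in> carrier_mat (dim_row B) (dim_row B)"
  have "\<exists>B. ?good i B" if "i < length Ws" for i
    using cyclic_primary_jordan_basis[OF A, of "Ws ! i" "fs ! i"] Ws fs that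
    by (metis list_all2_nthD nth_mem)
  then obtain block where block: "\<And>i. i < length Ws \<Longrightarrow> ?good i (block i)" by metis
  define Bs where "Bs = map block [0..<length Ws]"
  define B where "B = stack_rows n Bs"
  have len: "length fs = length Ws" using fs by (simp add: list_all2_lengthD)
  have "row_basis n (carrier_vec n) B"
    unfolding B_def using sum block
    by (intro direct_sum_row_basis) (auto simp: Bs_def list_all2_conv_all_nth)
  note basis = row_basis_carrier_vec[OF this] row_basis_carrier_vec_inverse[OF this]
  obtain C where C: "C \<in> carrier_mat n n" "B * C = 1\<^sub>m n" "C * B = 1\<^sub>m n" using basis(4) .
  note change = basis_change[OF basis(1) C]
  let ?J = "diag_block_mat (map gen_jordan_block fs)"
  have cols: "\<forall>D\<in>set Bs. dim_col D = n"
    using block by (auto simp: Bs_def row_basis_def)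
  have "list_all2 (\<lambda>B J. dim_col B = n \<and> J \<in> carrier_mat (dim_row B) (dim_row B) \<and> B * A = J * B)
      Bs (map gen_jordan_block fs)"
    unfolding list_all2_conv_all_nth
  proof (intro conjI allI impI)
    fix i assume "i < length Bs"
    then have "i < length Ws" by (simp add: Bs_def)
    then have "Bs ! i = block i" "map gen_jordan_block fs ! i = gen_jordan_block (fs ! i)"
      using len by (simp_all add: Bs_def)
    then show "dim_col (Bs ! i) = n"
      "map gen_jordan_block fs ! i \<in> carrier_mat (dim_row (Bs ! i)) (dim_row (Bs ! i))"
      "Bs ! i * A = map gen_jordan_block fs ! i * Bs ! i"
      using block[OF \<open>i < length Ws\<close>] by (simp_all only: row_basis_def)
  qed (simp add: Bs_def len)
  note stacked = stack_rows_intertwines[OF A this, folded B_def]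
  have "sum_list (map dim_row Bs) = n"
    using stack_rows_carrier[OF cols, folded B_def] basis(1) by (metis carrier_matD(1))
  with stacked have BA: "B * A = ?J * B" and J: "?J \<in> carrier_mat n n" by (simp_all only:)
  have "B * A * mat_inv B = ?J * (B * C)"
    unfolding BA change(2) by (rule assoc_mult_mat[OF J basis(1) C(1)])
  also have "\<dots> = ?J" unfolding C(2) by (rule right_mult_one_mat[OF J])
  finally have BAB: "B * A * mat_inv B = ?J" .
  have "mat_of_rows n (rows B) = B" using basis(1) by (metis carrier_matD(2) mat_of_rows_rows)
  then show ?thesis
    using basis(2,3) change(1,3) BAB by (intro exI[of _ "rows B"]) (simp only: Let_def simp_thms)
qed

end
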